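(* Let $\alpha,\beta\in(0,1)$, let $n\ge1$ and $1\le k\le n$ be integers (with $n\le N$ when $J=\{1,\dots,N\}$), and let $$\mathcal{S}_{k,n}=\{\theta\in l_2(J):\ \theta_j=0\ \text{for all } j>n,\ \mathrm{Card}\{j\le n:\theta_j\ne0\}\le k\}.$$ For $u\in(0,1)$, let $t_{n,1-u}(\sigma)$ be the $1-u$ quantile of $\sum_{j=1}^n\sigma_j^2\epsilon_j^2$, let $q_{n,1-u}$ be the $1-u$ quantile of $\max_{1\le j\le n}\epsilon_j^2$, and define the tests $$\Phi_u^{(1)}=\mathbf{1}_{\{\sum_{j=1}^nY_j^2>t_{n,1-u}(\sigma)\}},\qquad \Phi_u^{(2)}=\mathbf{1}_{\{\max_{1\le j\le n}Y_j^2/\sigma_j^2>q_{n,1-u}\}}.$$ Let $\Phi_\alpha=\max(\Phi_{\alpha/2}^{(1)},\Phi_{\alpha/2}^{(2)})$. Then $\Phi_\alpha$ is a level-$\alpha$ test: $\mathbb{P}_{\theta=0}(\Phi_\alpha=1)=\alpha$. There exists a constant $C(\alpha,\beta)$ such that for all $\theta\in\mathcal{S}_{k,n}$ satisfying $$\|\theta\|_2^2\ge C(\alpha,\beta)\Bigl[\Bigl(\sum_{j=1}^n\sigma_j^4\Bigr)^{1/2}\wedge\Bigl(\sum_{j:\,\theta_j\ne0}\sigma_j^2\Bigr)\ln(n)\Bigr],$$ one has $\mathbb{P}_\theta(\Phi_\alpha=1)>1-\beta$. Hence $$\rho_2^2(\mathcal{S}_{k,n},\alpha,\beta)\le C(\alpha,\beta)\Bigl[\Bigl(\sum_{j=1}^n\sigma_j^4\Bigr)^{1/2}\wedge\Sigma_{n-k,k}^2\ln(n)\Bigr],$$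 where $\Sigma_{n-k,k}^2=\sum_{j=n-k+1}^n\sigma_{(j)}^2$ and $\sigma_{(1)}\le\dots\le\sigma_{(n)}$ are the values $\sigma_1,\dots,\sigma_n$ arranged in non-decreasing order.
   Context: Model: $J=\{1,\dots,N\}$ for some integer $N\ge1$, or $J=\{1,2,3,\dots\}$. One observes $Y=(Y_j)_{j\in J}$ with $Y_j=\theta_j+\sigma_j\epsilon_j$, where $\theta=(\theta_j)_{j\in J}$ is unknown, $\sigma_j>0$ are known, and $(\epsilon_j)_{j\in J}$ are i.i.d. standard normal. $\mathbb{P}_\theta$ is the distribution of $Y$. $\|\theta\|_2^2=\sum_{j\in J}\theta_j^2$, and $x\wedge y=\min(x,y)$. A test is a measurable function $\Phi$ of $Y$ with values in $\{0,1\}$; the null hypothesis "$\theta=0$" is rejected iff $\Phi=1$. It has level $\alpha$ if $\mathbb{P}_0(\Phi=1)\le\alpha$. For $\mathcal{F}\subset l_2(J)$ and a level-$\alpha$ test $\Phi_\alpha$, $\rho_2(\Phi_\alpha,\mathcal{F},\beta)=\inf\{\rho>0:\ \inf_{\theta\in\mathcal{F},\|\theta\|_2\ge\rho}\mathbb{P}_\theta(\Phi_\alpha=1)>1-\beta\}$, and the $(\alpha,\beta)$ minimax rate of testing $\rho_2(\mathcal{F},\alpha,\beta)$ is the infimum of $\rho_2(\Phi_\alpha,\mathcal{F},\beta)$ over all level-$\alpha$ tests $\Phi_\alpha$.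
   Formalization: The level claim is proved as P_0(Φ_α=1) ≤ α (equality fails since the two rejection events overlap); the power claim is for θ ≠ 0 and n ≥ 2 and the rate bound for n ≥ 2, since the right-hand sides vanish at θ = 0 or n = 1 and the claims then fail, e.g. if α+β < 1. *)

theory Defs
  imports "HOL-Probability.Probability"
begin

text \<open>
  Signals and observations indexed by \<^term>\<open>J :: nat set\<close> are functions \<^typ>\<open>nat \<Rightarrow> real\<close> that are
  \<^const>\<open>extensional\<close> on \<^term>\<open>J\<close>, matching the sample space of \<^const>\<open>PiM\<close>. Coordinates start at 1.
\<close>

definition index_set :: "nat set \<Rightarrow> bool" where
  "index_set J \<longleftrightarrow> (\<exists>N\<ge>1. J = {1..N}) \<or> J = {1..}"

definition l2 :: "nat set \<Rightarrow> (nat \<Rightarrow> real) set" where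
  "l2 J = {\<theta> \<in> extensional J. (\<lambda>j. (\<theta> j)\<^sup>2) summable_on J}"

definition l2_norm :: "nat set \<Rightarrow> (nat \<Rightarrow> real) \<Rightarrow> real" where
  "l2_norm J \<theta> = sqrt (\<Sum>\<^sub>\<infinity>j\<in>J. (\<theta> j)\<^sup>2)"

definition zero_signal :: "nat set \<Rightarrow> nat \<Rightarrow> real" where
  "zero_signal J = (\<lambda>j\<in>J. 0)"

definition noise :: "nat set \<Rightarrow> (nat \<Rightarrow> real) measure" where
  "noise J = PiM J (\<lambda>_. std_normal_distribution)"

definition obs_dist :: "nat set \<Rightarrow> (nat \<Rightarrow> real) \<Rightarrow> (nat \<Rightarrow> real) \<Rightarrow> (nat \<Rightarrow> real) measure" where
  "obs_dist J \<sigma> \<theta> = distr (noise J) (PiM J (\<lambda>_. borel)) (\<lambda>\<epsilon>. \<lambda>j\<in>J. \<theta> j + \<sigma> j * \<epsilon> j)"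

definition is_test :: "nat set \<Rightarrow> ((nat \<Rightarrow> real) \<Rightarrow> real) \<Rightarrow> bool" where
  "is_test J \<Phi> \<longleftrightarrow> \<Phi> \<in> borel_measurable (PiM J (\<lambda>_. borel)) \<and>
     (\<forall>y\<in>space (PiM J (\<lambda>_. borel :: real measure)). \<Phi> y \<in> {0, 1})"

definition reject_prob ::
  "nat set \<Rightarrow> (nat \<Rightarrow> real) \<Rightarrow> (nat \<Rightarrow> real) \<Rightarrow> ((nat \<Rightarrow> real) \<Rightarrow> real) \<Rightarrow> real" where
  "reject_prob J \<sigma> \<theta> \<Phi> = \<P>(y in obs_dist J \<sigma> \<theta>. \<Phi> y = 1)"

definition level_test ::
  "nat set \<Rightarrow> (nat \<Rightarrow> real) \<Rightarrow> real \<Rightarrow> ((nat \<Rightarrow> real) \<Rightarrow> real) \<Rightarrow> bool" where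
  "level_test J \<sigma> \<alpha> \<Phi> \<longleftrightarrow> is_test J \<Phi> \<and> reject_prob J \<sigma> (zero_signal J) \<Phi> \<le> \<alpha>"

text \<open>
  Both quantities below live in \<^typ>\<open>ereal\<close> so that infima over empty sets are \<^term>\<open>\<infinity> :: ereal\<close>:
  a test may fail to reach the prescribed power at every radius.
\<close>

definition test_radius ::
  "nat set \<Rightarrow> (nat \<Rightarrow> real) \<Rightarrow> ((nat \<Rightarrow> real) \<Rightarrow> real) \<Rightarrow> (nat \<Rightarrow> real) set \<Rightarrow> real \<Rightarrow> ereal" where
  "test_radius J \<sigma> \<Phi> F \<beta> =
     Inf {ereal \<rho> |\<rho>. \<rho> > 0 \<and>
       (INF \<theta>\<in>{\<theta> \<in> F. l2_norm J \<theta> \<ge> \<rho>}. ereal (reject_prob J \<sigma> \<theta> \<Phi>)) > ereal (1 - \<beta>)}"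

definition minimax_rate ::
  "nat set \<Rightarrow> (nat \<Rightarrow> real) \<Rightarrow> (nat \<Rightarrow> real) set \<Rightarrow> real \<Rightarrow> real \<Rightarrow> ereal" where
  "minimax_rate J \<sigma> F \<alpha> \<beta> = (INF \<Phi>\<in>{\<Phi>. level_test J \<sigma> \<alpha> \<Phi>}. test_radius J \<sigma> \<Phi> F \<beta>)"

definition sparse_class :: "nat set \<Rightarrow> nat \<Rightarrow> nat \<Rightarrow> (nat \<Rightarrow> real) set" where
  "sparse_class J k n =
     {\<theta> \<in> l2 J. (\<forall>j\<in>J. j > n \<longrightarrow> \<theta> j = 0) \<and> card {j \<in> J. j \<le> n \<and> \<theta> j \<noteq> 0} \<le> k}"

definition quantile :: "real measure \<Rightarrow> real \<Rightarrow> real" where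
  "quantile M p = Inf {x. p \<le> cdf M x}"

definition sum_quantile :: "nat set \<Rightarrow> (nat \<Rightarrow> real) \<Rightarrow> nat \<Rightarrow> real \<Rightarrow> real" where
  "sum_quantile J \<sigma> n p =
     quantile (distr (noise J) borel (\<lambda>\<epsilon>. \<Sum>j=1..n. (\<sigma> j)\<^sup>2 * (\<epsilon> j)\<^sup>2)) p"

definition max_quantile :: "nat set \<Rightarrow> nat \<Rightarrow> real \<Rightarrow> real" where
  "max_quantile J n p =
     quantile (distr (noise J) borel (\<lambda>\<epsilon>. MAX j\<in>{1..n}. (\<epsilon> j)\<^sup>2)) p"

definition sum_test :: "nat set \<Rightarrow> (nat \<Rightarrow> real) \<Rightarrow> nat \<Rightarrow> real \<Rightarrow> (nat \<Rightarrow> real) \<Rightarrow> real" where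
  "sum_test J \<sigma> n u = indicator {y. (\<Sum>j=1..n. (y j)\<^sup>2) > sum_quantile J \<sigma> n (1 - u)}"

definition max_test :: "nat set \<Rightarrow> (nat \<Rightarrow> real) \<Rightarrow> nat \<Rightarrow> real \<Rightarrow> (nat \<Rightarrow> real) \<Rightarrow> real" where
  "max_test J \<sigma> n u =
     indicator {y. (MAX j\<in>{1..n}. (y j)\<^sup>2 / (\<sigma> j)\<^sup>2) > max_quantile J n (1 - u)}"

definition combined_test :: "nat set \<Rightarrow> (nat \<Rightarrow> real) \<Rightarrow> nat \<Rightarrow> real \<Rightarrow> (nat \<Rightarrow> real) \<Rightarrow> real" where
  "combined_test J \<sigma> n \<alpha> y = max (sum_test J \<sigma> n (\<alpha> / 2) y) (max_test J \<sigma> n (\<alpha> / 2) y)"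

text \<open>The \<^term>\<open>j\<close>-th smallest of the first \<^term>\<open>n\<close> noise levels, for \<^term>\<open>1 \<le> (j::nat)\<close>, \<^term>\<open>j \<le> (n::nat)\<close>.\<close>

definition sorted_sigma :: "(nat \<Rightarrow> real) \<Rightarrow> nat \<Rightarrow> nat \<Rightarrow> real" where
  "sorted_sigma \<sigma> n j = sort (map \<sigma> [1..<Suc n]) ! (j - 1)"

definition Sigma_sq :: "(nat \<Rightarrow> real) \<Rightarrow> nat \<Rightarrow> nat \<Rightarrow> real" where
  "Sigma_sq \<sigma> n k = (\<Sum>j=n-k+1..n. (sorted_sigma \<sigma> n j)\<^sup>2)"

end

theory Submission
  imports Defs
begin

text \<open>
  The two tests detect different kinds of signal, and the minimum in the separation condition says
  that at least one of them is in its favourable regime.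

  The energy \<open>\<Sum>j\<le>n. Y\<^sub>j\<^sup>2\<close> has mean \<open>\<parallel>\<theta>\<parallel>\<^sup>2 + \<Sum>j\<le>n. \<sigma>\<^sub>j\<^sup>2\<close> and, by independence and the first four
  Gaussian moments, variance \<open>\<Sum>j\<le>n. 4 \<theta>\<^sub>j\<^sup>2 \<sigma>\<^sub>j\<^sup>2 + 2 \<sigma>\<^sub>j\<^sup>4\<close>. Write \<open>V\<close> for the square root of
  \<open>\<Sum>j\<le>n. \<sigma>\<^sub>j\<^sup>4\<close>. Chebyshev's inequality at \<open>\<theta> = 0\<close> places the critical value within a multiple of
  \<open>V\<close> of the null mean (\<open>sum_quantile_le\<close>). As \<open>max \<sigma>\<^sub>j\<^sup>2 \<le> V\<close>, the variance under \<open>\<theta>\<close> is at most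
  \<open>2 V\<^sup>2 + 4 V \<parallel>\<theta>\<parallel>\<^sup>2\<close>, so a second use of Chebyshev's inequality shows that the test misses \<open>\<theta>\<close> with
  probability of order \<open>1/C\<close> once \<open>\<parallel>\<theta>\<parallel>\<^sup>2 \<ge> C V\<close> (\<open>energy_test_power\<close>).

  The critical value of the maximum is of order \<open>ln n\<close>, because a squared standard normal has an
  exponential tail (\<open>max_quantile_le\<close>). If \<open>\<parallel>\<theta>\<parallel>\<^sup>2\<close> is at least \<open>C ln n\<close> times the sum of \<open>\<sigma>\<^sub>j\<^sup>2\<close> over
  the support, then by pigeonhole some coordinate has \<open>\<theta>\<^sub>j\<^sup>2 \<ge> C \<sigma>\<^sub>j\<^sup>2 ln n\<close>, and this
  coordinate alone exceeds the critical value with high probability (\<open>peak_test_power\<close>).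

  The level is a union bound over the two tests, each run at \<open>\<alpha>/2\<close>. For the minimax rate, the sum of
  \<open>\<sigma>\<^sub>j\<^sup>2\<close> over a support of at most \<open>k\<close> coordinates is bounded by the sum over the \<open>k\<close> noisiest ones
  (\<open>sum_le_Sigma_sq\<close>). The power bound \<open>1 - 24/C\<close> is uniform in \<open>\<theta>\<close>, so taking \<open>24/C \<le> \<beta>/2\<close> keeps
  the infimum of the power strictly above \<open>1 - \<beta>\<close>.
\<close>

section \<open>Quantiles of real random variables\<close>

lemma (in prob_space) cdf_distribution_distr:
  fixes X :: "'a \<Rightarrow> real"
  assumes "random_variable borel X"
  shows "cdf_distribution (distr M borel X)"
proof -
  have "real_distribution (distr M borel X)"
    using assms by (rule real_distribution_distr)
  then show ?thesis
    by (simp add: cdf_distribution_def)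
qed

lemma (in prob_space) cdf_distr_eq_tail:
  fixes X :: "'a \<Rightarrow> real"
  assumes [measurable]: "random_variable borel X"
  shows "cdf (distr M borel X) x = 1 - prob {\<omega> \<in> space M. x < X \<omega>}"
proof -
  have "cdf (distr M borel X) x = prob {\<omega> \<in> space M. \<not> x < X \<omega>}"
    by (auto simp: cdf_def measure_distr not_less intro!: arg_cong[where f=prob])
  also have "\<dots> = 1 - prob {\<omega> \<in> space M. x < X \<omega>}"
    by (rule prob_neg) measurable
  finally show ?thesis .
qed

text \<open>
  Right continuity of the distribution function makes the infimum defining the quantile a minimum, so
  one equivalence serves two purposes: with \<open>x\<close> the quantile itself it bounds the error of the first
  kind, and with \<open>x\<close> a known tail bound it bounds the critical value.
\<close>

lemma (in prob_space) quantile_le_iff_tail: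
  fixes X :: "'a \<Rightarrow> real"
  assumes X: "random_variable borel X" and u: "0 < u" "u < 1"
  shows "quantile (distr M borel X) (1 - u) \<le> x \<longleftrightarrow> prob {\<omega> \<in> space M. x < X \<omega>} \<le> u"
proof -
  interpret D: cdf_distribution "distr M borel X"
    using X by (rule cdf_distribution_distr)
  show ?thesis
    using D.pseudoinverse[of "1 - u" x] u
    by (simp add: quantile_def cdf_distr_eq_tail[OF X])
qed

section \<open>Sums of independent centred variables\<close>

lemma (in prob_space) second_moment_indep_sum:
  fixes Z :: "'i \<Rightarrow> 'a \<Rightarrow> real"
  assumes "finite I" "indep_vars (\<lambda>_. borel) Z I"
    and "\<And>i. i \<in> I \<Longrightarrow> integrable M (Z i)"
    and "\<And>i. i \<in> I \<Longrightarrow> integrable M (\<lambda>\<omega>. (Z i \<omega>)\<^sup>2)"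
    and "\<And>i. i \<in> I \<Longrightarrow> expectation (Z i) = 0"
  shows "integrable M (\<lambda>\<omega>. (\<Sum>i\<in>I. Z i \<omega>)\<^sup>2)"
    and "expectation (\<lambda>\<omega>. (\<Sum>i\<in>I. Z i \<omega>)\<^sup>2) = (\<Sum>i\<in>I. expectation (\<lambda>\<omega>. (Z i \<omega>)\<^sup>2))"
proof -
  have "integrable M (\<lambda>\<omega>. (\<Sum>i\<in>I. Z i \<omega>)\<^sup>2) \<and>
    expectation (\<lambda>\<omega>. (\<Sum>i\<in>I. Z i \<omega>)\<^sup>2) = (\<Sum>i\<in>I. expectation (\<lambda>\<omega>. (Z i \<omega>)\<^sup>2))"
    using assms
  proof (induction I rule: finite_induct)
    case (insert i I)
    let ?S = "\<lambda>\<omega>. \<Sum>i\<in>I. Z i \<omega>"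
    have IH: "integrable M (\<lambda>\<omega>. (?S \<omega>)\<^sup>2)"
      "expectation (\<lambda>\<omega>. (?S \<omega>)\<^sup>2) = (\<Sum>i\<in>I. expectation (\<lambda>\<omega>. (Z i \<omega>)\<^sup>2))"
      using insert.IH insert.prems indep_vars_subset[OF insert.prems(1), of I] by auto
    have ind: "indep_var borel (Z i) borel ?S"
      using insert.hyps insert.prems(1) by (rule indep_vars_sum)
    have intS: "integrable M ?S"
      using insert.prems by auto
    have cross: "integrable M (\<lambda>\<omega>. Z i \<omega> * ?S \<omega>)"
      by (rule indep_var_integrable[OF ind _ intS]) (use insert.prems in auto)
    have "expectation (\<lambda>\<omega>. Z i \<omega> * ?S \<omega>) = expectation (Z i) * expectation ?S"
      by (rule indep_var_lebesgue_integral[OF ind _ intS]) (use insert.prems in auto)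
    then have cross0: "expectation (\<lambda>\<omega>. Z i \<omega> * ?S \<omega>) = 0"
      using insert.prems(4)[of i] by simp
    have eq: "(\<Sum>i\<in>insert i I. Z i \<omega>)\<^sup>2 = (Z i \<omega>)\<^sup>2 + (?S \<omega>)\<^sup>2 + 2 * (Z i \<omega> * ?S \<omega>)" for \<omega>
      using insert.hyps by (simp add: power2_sum)
    have intZ: "integrable M (\<lambda>\<omega>. (Z i \<omega>)\<^sup>2)"
      using insert.prems by auto
    show ?case
      unfolding eq using IH intZ cross cross0 insert.hyps by simp
  qed simp
  then show "integrable M (\<lambda>\<omega>. (\<Sum>i\<in>I. Z i \<omega>)\<^sup>2)"
    and "expectation (\<lambda>\<omega>. (\<Sum>i\<in>I. Z i \<omega>)\<^sup>2) = (\<Sum>i\<in>I. expectation (\<lambda>\<omega>. (Z i \<omega>)\<^sup>2))"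
    by auto
qed

lemma (in prob_space) Chebyshev_indep_sum:
  fixes Z :: "'i \<Rightarrow> 'a \<Rightarrow> real"
  assumes "finite I" "indep_vars (\<lambda>_. borel) Z I"
    and "\<And>i. i \<in> I \<Longrightarrow> integrable M (Z i)"
    and "\<And>i. i \<in> I \<Longrightarrow> integrable M (\<lambda>\<omega>. (Z i \<omega>)\<^sup>2)"
    and "\<And>i. i \<in> I \<Longrightarrow> expectation (Z i) = 0"
    and "0 < a"
  shows "prob {\<omega> \<in> space M. a \<le> \<bar>\<Sum>i\<in>I. Z i \<omega>\<bar>} \<le> (\<Sum>i\<in>I. expectation (\<lambda>\<omega>. (Z i \<omega>)\<^sup>2)) / a\<^sup>2"
proof -
  let ?S = "\<lambda>\<omega>. \<Sum>i\<in>I. Z i \<omega>"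
  have int: "integrable M ?S" and mean: "expectation ?S = 0"
    using assms by auto
  have "prob {\<omega> \<in> space M. a \<le> \<bar>?S \<omega> - expectation ?S\<bar>} \<le> variance ?S / a\<^sup>2"
    using int second_moment_indep_sum(1)[OF assms(1-5)] assms(6)
    by (intro Chebyshev_inequality) auto
  then show ?thesis
    by (simp add: mean second_moment_indep_sum(2)[OF assms(1-5)])
qed

section \<open>Moments and tail of the standard normal distribution\<close>

lemma std_normal_power_integrable:
  "integrable std_normal_distribution (\<lambda>x. x ^ k)"
  using integrable_std_normal_moment[of k]
  by (simp add: integrable_density)

lemma std_normal_low_moments:
  "(\<integral>x. x \<partial>std_normal_distribution) = 0"
  "(\<integral>x. x\<^sup>2 \<partial>std_normal_distribution) = 1"
  "(\<integral>x. x ^ 3 \<partial>std_normal_distribution) = 0"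
  "(\<integral>x. x ^ 4 \<partial>std_normal_distribution) = 3"
  using integral_std_normal_moment_odd[of 0] integral_std_normal_moment_even[of 1]
    integral_std_normal_moment_odd[of 1] integral_std_normal_moment_even[of 2]
  by (simp_all add: integral_density fact_numeral numeral_3_eq_3)

text \<open>
  The polynomial is, up to its constant, a squared shifted Gaussian \<open>(\<theta> + \<sigma> x)\<^sup>2\<close>, with \<^term>\<open>a = 2 * \<theta> * \<sigma>\<close> and
  \<^term>\<open>b = \<sigma>\<^sup>2\<close>. Its two terms are orthogonal because the odd moments vanish.
\<close>

lemma std_normal_quadratic:
  fixes a b :: real
  defines "g \<equiv> \<lambda>x. a * x + b * (x\<^sup>2 - 1)"
  shows "integrable std_normal_distribution g"
    and "(\<integral>x. g x \<partial>std_normal_distribution) = 0"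
    and "integrable std_normal_distribution (\<lambda>x. (g x)\<^sup>2)"
    and "(\<integral>x. (g x)\<^sup>2 \<partial>std_normal_distribution) = a\<^sup>2 + 2 * b\<^sup>2"
proof -
  interpret prob_space std_normal_distribution
    by (rule prob_space_normal_density) simp
  note [simp] = prob_space[simplified] std_normal_power_integrable std_normal_power_integrable[of 1, simplified]
  have sq: "(g x)\<^sup>2 = b\<^sup>2 * x ^ 4 + (2 * a * b) * x ^ 3 + (a\<^sup>2 - 2 * b\<^sup>2) * x\<^sup>2 - (2 * a * b) * x + b\<^sup>2" for x
    unfolding g_def by algebra
  show "integrable std_normal_distribution g"
    "integrable std_normal_distribution (\<lambda>x. (g x)\<^sup>2)"
    unfolding sq by (auto simp: g_def)
  show "(\<integral>x. g x \<partial>std_normal_distribution) = 0"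
    unfolding g_def by (simp add: std_normal_low_moments prob_space)
  show "(\<integral>x. (g x)\<^sup>2 \<partial>std_normal_distribution) = a\<^sup>2 + 2 * b\<^sup>2"
    unfolding sq by (simp add: std_normal_low_moments prob_space)
qed

text \<open>
  The weight \<^term>\<open>exp (x\<^sup>2 / 4)\<close> turns the standard normal density into a multiple of the centred normal
  density of variance 2.
\<close>

lemma std_normal_exp_quarter_square:
  "integrable std_normal_distribution (\<lambda>x. exp (x\<^sup>2 / 4))"
  "(\<integral>x. exp (x\<^sup>2 / 4) \<partial>std_normal_distribution) = sqrt 2"
proof -
  have eq: "std_normal_density x * exp (x\<^sup>2 / 4) = sqrt 2 * normal_density 0 (sqrt 2) x" for x
  proof -
    have "exp (- x\<^sup>2 / 2) * exp (x\<^sup>2 / 4) = exp (- x\<^sup>2 / 4)"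
      by (simp flip: exp_add)
    then show ?thesis
      by (simp add: normal_density_def real_sqrt_mult field_simps)
  qed
  show "integrable std_normal_distribution (\<lambda>x. exp (x\<^sup>2 / 4))"
    by (simp add: integrable_density eq)
  show "(\<integral>x. exp (x\<^sup>2 / 4) \<partial>std_normal_distribution) = sqrt 2"
    by (simp add: integral_density eq)
qed

text \<open>Markov's inequality for the exponential moment, with the constant rounded up to 2.\<close>

lemma std_normal_square_tail:
  "measure std_normal_distribution {x. t < x\<^sup>2} \<le> 2 * exp (- t / 4)"
proof -
  interpret prob_space std_normal_distribution
    by (rule prob_space_normal_density) simp
  have "prob {x \<in> space std_normal_distribution. exp (t / 4) \<le> exp (x\<^sup>2 / 4)} \<le> sqrt 2 / exp (t / 4)"
    using std_normal_exp_quarter_square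
      integral_Markov_inequality_measure[of std_normal_distribution "\<lambda>x. exp (x\<^sup>2 / 4)" "{}" "exp (t / 4)"]
    by simp
  moreover have "prob {x. t < x\<^sup>2} \<le> prob {x \<in> space std_normal_distribution. exp (t / 4) \<le> exp (x\<^sup>2 / 4)}"
    by (intro finite_measure_mono) auto
  moreover have "sqrt 2 / exp (t / 4) \<le> 2 * exp (- t / 4)"
    using real_sqrt_le_mono[of 2 4] by (simp add: exp_minus field_simps)
  ultimately show ?thesis by simp
qed

lemma std_normal_square_Markov:
  assumes "0 < t"
  shows "measure std_normal_distribution {x. t \<le> x\<^sup>2} \<le> 1 / t"
  using integral_Markov_inequality_measure[of std_normal_distribution "\<lambda>x. x\<^sup>2" "{}" t] assms
  by (simp add: std_normal_power_integrable std_normal_low_moments)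

section \<open>The largest noise levels\<close>

text \<open>
  With \<open>c\<close> the \<open>k\<close>-th largest entry, replace each term by \<open>max (x - c) 0 + c\<close>. The excess over \<open>c\<close> is
  nonnegative, so its sum can be extended to all indices; that full sum does not depend on the order
  of the entries, and in the sorted list only the top \<open>k\<close> entries contribute to it. This avoids
  comparing the chosen index set with an explicit sorting permutation.
\<close>

lemma sum_subset_le_sum_top:
  fixes xs :: "real list"
  assumes xs: "mset xs = mset (map f [1..<Suc n])" and sorted: "sorted xs"
    and S: "S \<subseteq> {1..n}" "card S \<le> k" and k: "1 \<le> k" "k \<le> n"
    and nonneg: "\<And>x. x \<in> set xs \<Longrightarrow> 0 \<le> x"
  shows "(\<Sum>j\<in>S. f j) \<le> (\<Sum>i\<in>{n-k..<n}. xs ! i)"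
proof -
  have len: "length xs = n"
    using arg_cong[OF xs, of size] by simp
  define c where "c = xs ! (n - k)"
  define g where "g x = max (x - c) 0" for x :: real
  have c: "0 \<le> c"
    unfolding c_def using nonneg k len by simp
  have finS: "finite S"
    using S(1) finite_subset by blast
  have "(\<Sum>j\<in>S. f j) \<le> (\<Sum>j\<in>S. g (f j) + c)"
    by (intro sum_mono) (simp add: g_def)
  also have "\<dots> = (\<Sum>j\<in>S. g (f j)) + real (card S) * c"
    by (simp add: sum.distrib)
  also have "\<dots> \<le> (\<Sum>j\<in>{1..n}. g (f j)) + real k * c"
    using S c by (intro add_mono sum_mono2 mult_right_mono) (auto simp: g_def)
  also have "(\<Sum>j\<in>{1..n}. g (f j)) = (\<Sum>i<n. g (xs ! i))"
  proof -
    have "(\<Sum>j\<in>{1..n}. g (f j)) = sum_list (map g (map f [1..<Suc n]))"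
      by (simp add: sum_list_distinct_conv_sum_set atLeastLessThanSuc_atLeastAtMost comp_def del: upt_Suc)
    also have "\<dots> = sum_list (map g xs)"
      by (metis mset_map sum_mset_sum_list xs)
    also have "\<dots> = (\<Sum>i<n. g (xs ! i))"
      by (simp add: sum_list_sum_nth len atLeast0LessThan)
    finally show ?thesis .
  qed
  also have "(\<Sum>i<n. g (xs ! i)) = (\<Sum>i\<in>{n-k..<n}. xs ! i - c)"
  proof (rule sum.mono_neutral_cong_right)
    show "\<forall>i\<in>{..<n} - {n-k..<n}. g (xs ! i) = 0"
      using sorted_nth_mono[OF sorted, of _ "n - k"] k len by (auto simp: g_def c_def)
    show "g (xs ! i) = xs ! i - c" if "i \<in> {n-k..<n}" for i
      using that sorted_nth_mono[OF sorted, of "n-k" i] len by (auto simp: g_def c_def)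
  qed auto
  also have "\<dots> + real k * c = (\<Sum>i\<in>{n-k..<n}. xs ! i)"
    using k by (simp add: sum_subtractf)
  finally show ?thesis by simp
qed

lemma sum_le_Sigma_sq:
  assumes S: "S \<subseteq> {1..n}" "card S \<le> k" and k: "1 \<le> k" "k \<le> n"
    and pos: "\<And>j. j \<in> {1..n} \<Longrightarrow> 0 < \<sigma> j"
  shows "(\<Sum>j\<in>S. (\<sigma> j)\<^sup>2) \<le> Sigma_sq \<sigma> n k"
proof -
  let ?s = "sort (map \<sigma> [1..<Suc n])"
  define xs where "xs = map (\<lambda>x. x\<^sup>2) ?s"
  have pos_s: "0 < x" if "x \<in> set ?s" for x
    using that pos by (auto simp del: upt_Suc)
  have "(\<Sum>j\<in>S. (\<sigma> j)\<^sup>2) \<le> (\<Sum>i\<in>{n-k..<n}. xs ! i)"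
  proof (rule sum_subset_le_sum_top[OF _ _ S k])
    show "mset xs = mset (map (\<lambda>j. (\<sigma> j)\<^sup>2) [1..<Suc n])"
      unfolding xs_def by (simp add: image_mset.compositionality comp_def del: upt_Suc)
    show "sorted xs"
      unfolding xs_def sorted_wrt_map
      by (rule sorted_wrt_mono_rel[OF _ sorted_sort])
         (use pos_s in \<open>auto intro!: power_mono simp: less_imp_le simp del: upt_Suc\<close>)
  qed (auto simp: xs_def)
  also have "\<dots> = (\<Sum>i\<in>{n-k..<n}. (?s ! i)\<^sup>2)"
    by (intro sum.cong) (auto simp: xs_def simp del: upt_Suc)
  also have "\<dots> = (\<Sum>j\<in>{Suc (n-k)..<Suc n}. (?s ! (j - 1))\<^sup>2)"
    by (subst sum.shift_bounds_Suc_ivl) simp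
  also have "\<dots> = Sigma_sq \<sigma> n k"
    unfolding Sigma_sq_def sorted_sigma_def by (intro sum.cong) auto
  finally show ?thesis .
qed

section \<open>The Gaussian sequence model\<close>

text \<open>
  All events are expressed through the noise \<open>\<epsilon>\<close> instead of the observation \<open>Y\<close>, so that every signal
  \<open>\<theta>\<close> is studied on the same probability space.
\<close>

locale gaussian_sequence =
  fixes J :: "nat set" and \<sigma> :: "nat \<Rightarrow> real" and n :: nat
  assumes index_set: "index_set J"
    and sigma_pos: "\<And>j. j \<in> J \<Longrightarrow> 0 < \<sigma> j"
    and n_pos: "1 \<le> n"
    and window: "{1..n} \<subseteq> J"
begin

lemma J_ge_1: "j \<in> J \<Longrightarrow> 1 \<le> j"
  using index_set by (auto simp: index_set_def)

lemma in_window [simp]: "1 \<le> j \<Longrightarrow> j \<le> n \<Longrightarrow> j \<in> J"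
  using window by auto

lemma J_nonempty: "J \<noteq> {}"
  using window n_pos by auto

lemma space_noise: "space (noise J) = extensional J"
  by (simp add: noise_def space_PiM PiE_def)

lemma sets_noise [measurable_cong]: "sets (noise J) = sets (PiM J (\<lambda>_. borel))"
  unfolding noise_def by (intro sets_PiM_cong) auto

sublocale prob_space "noise J"
  unfolding noise_def by (intro prob_space_PiM prob_space_normal_density) simp

lemma coordinate_distr:
  assumes "j \<in> J"
  shows "distr (noise J) borel (\<lambda>\<epsilon>. \<epsilon> j) = std_normal_distribution"
proof -
  have "distr (noise J) borel (\<lambda>\<epsilon>. \<epsilon> j) = distr (noise J) std_normal_distribution (\<lambda>\<epsilon>. \<epsilon> j)"
    by (intro distr_cong) auto
  also have "\<dots> = std_normal_distribution"
    unfolding noise_def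
    by (rule distr_PiM_component) (use assms in \<open>auto intro: prob_space_normal_density\<close>)
  finally show ?thesis .
qed

lemma coordinate_measurable:
  assumes "j \<in> J"
  shows "random_variable borel (\<lambda>\<epsilon>. \<epsilon> j)"
  using assms by measurable

lemma coordinate_prob:
  assumes j: "j \<in> J" and P: "{x. P x} \<in> sets borel"
  shows "prob {\<epsilon> \<in> space (noise J). P (\<epsilon> j)} = measure std_normal_distribution {x. P x}"
proof -
  have "measure std_normal_distribution {x. P x} = measure (distr (noise J) borel (\<lambda>\<epsilon>. \<epsilon> j)) {x. P x}"
    by (simp add: coordinate_distr[OF j])
  also have "\<dots> = prob {\<epsilon> \<in> space (noise J). P (\<epsilon> j)}"
    using coordinate_measurable[OF j] P
    by (subst measure_distr) (auto intro!: arg_cong[where f=prob])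
  finally show ?thesis ..
qed

lemma coordinate_integral:
  fixes g :: "real \<Rightarrow> real"
  assumes j: "j \<in> J" and g: "g \<in> borel_measurable borel"
  shows "integrable (noise J) (\<lambda>\<epsilon>. g (\<epsilon> j)) \<longleftrightarrow> integrable std_normal_distribution g"
    and "expectation (\<lambda>\<epsilon>. g (\<epsilon> j)) = (\<integral>x. g x \<partial>std_normal_distribution)"
  using integrable_distr_eq[OF coordinate_measurable[OF j] g]
    integral_distr[OF coordinate_measurable[OF j] g]
  by (simp_all add: coordinate_distr[OF j])

lemma coordinates_indep: "indep_vars (\<lambda>_. borel) (\<lambda>j \<epsilon>. \<epsilon> j) J"
proof -
  have "distr (noise J) (PiM J (\<lambda>_. borel)) (\<lambda>\<epsilon>. \<lambda>j\<in>J. \<epsilon> j) = distr (noise J) (noise J) (\<lambda>\<epsilon>. \<epsilon>)"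
    by (intro distr_cong) (auto simp: sets_noise space_noise extensional_restrict)
  also have "\<dots> = noise J"
    by (rule distr_id)
  also have "\<dots> = (\<Pi>\<^sub>M j\<in>J. distr (noise J) borel (\<lambda>\<epsilon>. \<epsilon> j))"
    by (subst noise_def) (intro PiM_cong, simp_all add: coordinate_distr)
  finally show ?thesis
    using J_nonempty coordinate_measurable by (subst indep_vars_iff_distr_eq_PiM') auto
qed

definition energy :: "(nat \<Rightarrow> real) \<Rightarrow> (nat \<Rightarrow> real) \<Rightarrow> real" where
  "energy \<theta> \<epsilon> = (\<Sum>j=1..n. (\<theta> j + \<sigma> j * \<epsilon> j)\<^sup>2)"

definition peak :: "(nat \<Rightarrow> real) \<Rightarrow> (nat \<Rightarrow> real) \<Rightarrow> real" where
  "peak \<theta> \<epsilon> = (MAX j\<in>{1..n}. (\<theta> j + \<sigma> j * \<epsilon> j)\<^sup>2 / (\<sigma> j)\<^sup>2)"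

text \<open>Up to the factor \<open>sqrt 2\<close>, the standard deviation of the energy under the null hypothesis.\<close>

definition noise_scale :: real where
  "noise_scale = sqrt (\<Sum>j=1..n. \<sigma> j ^ 4)"

lemma energy_measurable [measurable]: "random_variable borel (energy \<theta>)"
  unfolding energy_def by measurable

lemma peak_measurable [measurable]: "random_variable borel (peak \<theta>)"
  unfolding peak_def using n_pos by (intro borel_measurable_Max) auto

lemma energy_cong: "(\<And>j. 1 \<le> j \<Longrightarrow> j \<le> n \<Longrightarrow> \<theta> j = \<theta>' j) \<Longrightarrow> energy \<theta> = energy \<theta>'"
  by (auto simp: energy_def fun_eq_iff intro!: sum.cong)

lemma peak_cong: "(\<And>j. 1 \<le> j \<Longrightarrow> j \<le> n \<Longrightarrow> \<theta> j = \<theta>' j) \<Longrightarrow> peak \<theta> = peak \<theta>'"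
  by (auto simp: peak_def fun_eq_iff intro!: arg_cong[where f=Max] image_cong)

lemma energy_null: "energy (\<lambda>_. 0) = (\<lambda>\<epsilon>. \<Sum>j=1..n. (\<sigma> j)\<^sup>2 * (\<epsilon> j)\<^sup>2)"
  by (simp add: energy_def fun_eq_iff power_mult_distrib)

lemma peak_null: "peak (\<lambda>_. 0) = (\<lambda>\<epsilon>. MAX j\<in>{1..n}. (\<epsilon> j)\<^sup>2)"
proof -
  have "(0 + \<sigma> j * \<epsilon> j)\<^sup>2 / (\<sigma> j)\<^sup>2 = (\<epsilon> j)\<^sup>2" if "j \<in> {1..n}" for j \<epsilon>
    using sigma_pos[of j] that by (simp add: power_mult_distrib)
  then show ?thesis
    unfolding peak_def by (intro ext arg_cong[where f=Max] image_cong) auto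
qed

lemma combined_test_eq:
  "combined_test J \<sigma> n \<alpha> y =
    (if sum_quantile J \<sigma> n (1 - \<alpha> / 2) < (\<Sum>j=1..n. (y j)\<^sup>2) \<or>
        max_quantile J n (1 - \<alpha> / 2) < (MAX j\<in>{1..n}. (y j)\<^sup>2 / (\<sigma> j)\<^sup>2) then 1 else 0)"
  by (simp add: combined_test_def sum_test_def max_test_def indicator_def)

lemma combined_test_is_test: "is_test J (combined_test J \<sigma> n \<alpha>)"
proof -
  have [measurable]: "(\<lambda>y. MAX j\<in>{1..n}. (y j)\<^sup>2 / (\<sigma> j)\<^sup>2) \<in> borel_measurable (PiM J (\<lambda>_. borel))"
    using n_pos by (intro borel_measurable_Max) auto
  show ?thesis
    unfolding is_test_def combined_test_eq by (auto intro!: measurable_If) measurable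
qed

lemma reject_prob_combined_test:
  "reject_prob J \<sigma> \<theta> (combined_test J \<sigma> n \<alpha>) =
    prob {\<epsilon> \<in> space (noise J). sum_quantile J \<sigma> n (1 - \<alpha> / 2) < energy \<theta> \<epsilon> \<or>
      max_quantile J n (1 - \<alpha> / 2) < peak \<theta> \<epsilon>}"
proof -
  let ?\<Phi> = "combined_test J \<sigma> n \<alpha>"
  let ?Y = "\<lambda>\<epsilon>. \<lambda>j\<in>J. \<theta> j + \<sigma> j * \<epsilon> j"
  have Y: "?Y \<in> measurable (noise J) (PiM J (\<lambda>_. borel))"
    by measurable
  have [measurable]: "?\<Phi> \<in> borel_measurable (PiM J (\<lambda>_. borel))"
    using combined_test_is_test by (simp add: is_test_def)
  have "reject_prob J \<sigma> \<theta> ?\<Phi> = prob {\<epsilon> \<in> space (noise J). ?\<Phi> (?Y \<epsilon>) = 1}"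
    unfolding reject_prob_def obs_dist_def
    using measurable_space[OF Y]
    by (subst measure_distr[OF Y]) (auto intro!: arg_cong[where f=prob])
  also have "\<dots> = prob {\<epsilon> \<in> space (noise J). sum_quantile J \<sigma> n (1 - \<alpha> / 2) < energy \<theta> \<epsilon> \<or>
      max_quantile J n (1 - \<alpha> / 2) < peak \<theta> \<epsilon>}"
  proof -
    have "(\<Sum>j=1..n. (?Y \<epsilon> j)\<^sup>2) = energy \<theta> \<epsilon>" for \<epsilon>
      unfolding energy_def by (intro sum.cong) auto
    moreover have "(MAX j\<in>{1..n}. (?Y \<epsilon> j)\<^sup>2 / (\<sigma> j)\<^sup>2) = peak \<theta> \<epsilon>" for \<epsilon>
      unfolding peak_def by (intro arg_cong[where f=Max] image_cong) auto
    ultimately show ?thesis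
      by (auto simp: combined_test_eq simp del: One_nat_def intro!: arg_cong[where f=prob])
  qed
  finally show ?thesis .
qed

section \<open>Level\<close>

lemma sum_quantile_le_iff:
  assumes "0 < u" "u < 1"
  shows "sum_quantile J \<sigma> n (1 - u) \<le> x \<longleftrightarrow>
    prob {\<epsilon> \<in> space (noise J). x < energy (\<lambda>_. 0) \<epsilon>} \<le> u"
  unfolding sum_quantile_def energy_null[symmetric]
  using assms by (intro quantile_le_iff_tail) measurable

lemma max_quantile_le_iff:
  assumes "0 < u" "u < 1"
  shows "max_quantile J n (1 - u) \<le> x \<longleftrightarrow>
    prob {\<epsilon> \<in> space (noise J). x < peak (\<lambda>_. 0) \<epsilon>} \<le> u"
  unfolding max_quantile_def peak_null[symmetric]
  using assms by (intro quantile_le_iff_tail) measurable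

lemma combined_test_level:
  assumes \<alpha>: "0 < \<alpha>" "\<alpha> < 1"
  shows "level_test J \<sigma> \<alpha> (combined_test J \<sigma> n \<alpha>)"
proof -
  let ?t = "sum_quantile J \<sigma> n (1 - \<alpha> / 2)" and ?q = "max_quantile J n (1 - \<alpha> / 2)"
  let ?A = "{\<epsilon> \<in> space (noise J). ?t < energy (\<lambda>_. 0) \<epsilon>}"
  let ?B = "{\<epsilon> \<in> space (noise J). ?q < peak (\<lambda>_. 0) \<epsilon>}"
  have zero: "energy (zero_signal J) = energy (\<lambda>_. 0)" "peak (zero_signal J) = peak (\<lambda>_. 0)"
    by (auto intro!: energy_cong peak_cong simp: zero_signal_def)
  have "reject_prob J \<sigma> (zero_signal J) (combined_test J \<sigma> n \<alpha>) = prob (?A \<union> ?B)"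
    unfolding reject_prob_combined_test zero by (intro arg_cong[where f=prob]) auto
  also have "\<dots> \<le> prob ?A + prob ?B"
    by (rule measure_Un_le) measurable
  also have "\<dots> \<le> \<alpha> / 2 + \<alpha> / 2"
    using \<alpha> sum_quantile_le_iff[of "\<alpha> / 2" ?t] max_quantile_le_iff[of "\<alpha> / 2" ?q]
    by (intro add_mono) auto
  finally show ?thesis
    by (simp add: level_test_def combined_test_is_test)
qed

section \<open>Power of the energy test\<close>

text \<open>
  The centred energy is a sum of independent terms \<open>2 \<theta>\<^sub>j \<sigma>\<^sub>j \<epsilon>\<^sub>j + \<sigma>\<^sub>j\<^sup>2 (\<epsilon>\<^sub>j\<^sup>2 - 1)\<close>, so Chebyshev's inequality
  applies. The instance \<open>\<theta> = 0\<close> controls the critical value, the general one the power.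
\<close>

lemma energy_deviation:
  assumes "0 < a"
  shows "prob {\<epsilon> \<in> space (noise J). a \<le> \<bar>energy \<theta> \<epsilon> - ((\<Sum>j=1..n. (\<theta> j)\<^sup>2) + (\<Sum>j=1..n. (\<sigma> j)\<^sup>2))\<bar>}
    \<le> (4 * (\<Sum>j=1..n. (\<theta> j)\<^sup>2 * (\<sigma> j)\<^sup>2) + 2 * noise_scale\<^sup>2) / a\<^sup>2"
proof -
  define g where "g j x = (2 * \<theta> j * \<sigma> j) * x + (\<sigma> j)\<^sup>2 * (x\<^sup>2 - 1)" for j and x :: real
  have [measurable]: "g j \<in> borel_measurable borel" for j
    unfolding g_def by measurable
  note quad = std_normal_quadratic[of "2 * \<theta> j * \<sigma> j" "(\<sigma> j)\<^sup>2" for j, folded g_def]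
  have centred: "energy \<theta> \<epsilon> - ((\<Sum>j=1..n. (\<theta> j)\<^sup>2) + (\<Sum>j=1..n. (\<sigma> j)\<^sup>2)) = (\<Sum>j=1..n. g j (\<epsilon> j))" for \<epsilon>
    unfolding energy_def g_def sum.distrib[symmetric] sum_subtractf[symmetric]
    by (intro sum.cong) (auto simp: power2_eq_square algebra_simps)
  have moment: "expectation (\<lambda>\<epsilon>. (g j (\<epsilon> j))\<^sup>2) = (2 * \<theta> j * \<sigma> j)\<^sup>2 + 2 * ((\<sigma> j)\<^sup>2)\<^sup>2"
    if "j \<in> {1..n}" for j
    using that coordinate_integral(2)[of j "\<lambda>x. (g j x)\<^sup>2"] quad(4)[of j] by simp
  have "prob {\<epsilon> \<in> space (noise J). a \<le> \<bar>\<Sum>j\<in>{1..n}. g j (\<epsilon> j)\<bar>}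
    \<le> (\<Sum>j\<in>{1..n}. expectation (\<lambda>\<epsilon>. (g j (\<epsilon> j))\<^sup>2)) / a\<^sup>2"
  proof (rule Chebyshev_indep_sum)
    show "indep_vars (\<lambda>_. borel) (\<lambda>j \<epsilon>. g j (\<epsilon> j)) {1..n}"
      by (rule indep_vars_compose2[OF indep_vars_subset[OF coordinates_indep window]]) measurable
  qed (use assms quad coordinate_integral(1)[of _ "g _"] coordinate_integral(2)[of _ "g _"]
        coordinate_integral(1)[of _ "\<lambda>x. (g _ x)\<^sup>2"] in auto)
  also have "(\<Sum>j\<in>{1..n}. expectation (\<lambda>\<epsilon>. (g j (\<epsilon> j))\<^sup>2))
      = (\<Sum>j=1..n. 4 * ((\<theta> j)\<^sup>2 * (\<sigma> j)\<^sup>2) + 2 * \<sigma> j ^ 4)"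
    by (intro sum.cong refl) (simp add: moment power_mult_distrib flip: power_mult)
  also have "\<dots> = 4 * (\<Sum>j=1..n. (\<theta> j)\<^sup>2 * (\<sigma> j)\<^sup>2) + 2 * noise_scale\<^sup>2"
    by (simp add: sum.distrib sum_distrib_left noise_scale_def sum_nonneg)
  finally show ?thesis
    by (simp only: centred)
qed

lemma noise_scale_pos: "0 < noise_scale"
proof -
  have "0 < (\<Sum>j=1..n. \<sigma> j ^ 4)"
    using n_pos sigma_pos by (intro sum_pos zero_less_power) auto
  then show ?thesis
    by (simp add: noise_scale_def)
qed

lemma sigma_sq_le_noise_scale:
  assumes "j \<in> {1..n}"
  shows "(\<sigma> j)\<^sup>2 \<le> noise_scale"
proof -
  have "((\<sigma> j)\<^sup>2)\<^sup>2 \<le> (\<Sum>j=1..n. \<sigma> j ^ 4)"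
    using member_le_sum[of j "{1..n}" "\<lambda>j. \<sigma> j ^ 4"] assms by (simp flip: power_mult)
  then show ?thesis
    unfolding noise_scale_def by (rule real_le_rsqrt)
qed

lemma sum_quantile_le:
  assumes u: "0 < u" "u < 1"
  shows "sum_quantile J \<sigma> n (1 - u) \<le> (\<Sum>j=1..n. (\<sigma> j)\<^sup>2) + sqrt (2 / u) * noise_scale"
proof -
  let ?a = "sqrt (2 / u) * noise_scale"
  have a: "0 < ?a"
    using u noise_scale_pos by simp
  have "prob {\<epsilon> \<in> space (noise J). (\<Sum>j=1..n. (\<sigma> j)\<^sup>2) + ?a < energy (\<lambda>_. 0) \<epsilon>}
    \<le> prob {\<epsilon> \<in> space (noise J). ?a \<le> \<bar>energy (\<lambda>_. 0) \<epsilon> - ((\<Sum>j=1..n. 0\<^sup>2) + (\<Sum>j=1..n. (\<sigma> j)\<^sup>2))\<bar>}"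
    by (intro finite_measure_mono) auto
  also have "\<dots> \<le> 2 * noise_scale\<^sup>2 / ?a\<^sup>2"
    using energy_deviation[OF a, of "\<lambda>_. 0"] by simp
  also have "\<dots> = u"
    using u noise_scale_pos by (simp add: power_mult_distrib)
  finally show ?thesis
    using sum_quantile_le_iff[OF u] by simp
qed

text \<open>
  The lower bound on \<open>C\<close> keeps the critical value below the null mean plus half of \<open>s = \<parallel>\<theta>\<parallel>\<^sup>2\<close>, so a
  miss forces the energy to deviate from its mean by at least \<open>s / 2\<close>.
\<close>

lemma energy_test_power:
  assumes u: "0 < u" "u < 1" and C: "1 \<le> C" "2 * sqrt (2 / u) \<le> C"
    and large: "C * noise_scale \<le> (\<Sum>j=1..n. (\<theta> j)\<^sup>2)"
  shows "prob {\<epsilon> \<in> space (noise J). energy \<theta> \<epsilon> \<le> sum_quantile J \<sigma> n (1 - u)} \<le> 24 / C"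
proof -
  let ?V = noise_scale and ?t = "sum_quantile J \<sigma> n (1 - u)"
  define s where "s = (\<Sum>j=1..n. (\<theta> j)\<^sup>2)"
  have V: "0 < ?V"
    by (rule noise_scale_pos)
  have CV: "0 < C * ?V"
    using V C by simp
  have s: "C * ?V \<le> s" "0 < s"
    using large CV by (simp_all add: s_def)
  have cross: "(\<Sum>j=1..n. (\<theta> j)\<^sup>2 * (\<sigma> j)\<^sup>2) \<le> s * ?V"
    unfolding s_def sum_distrib_right
    by (intro sum_mono mult_left_mono sigma_sq_le_noise_scale) auto
  have "2 * sqrt (2 / u) * ?V \<le> C * ?V"
    using C(2) V by (intro mult_right_mono) auto
  then have t: "?t \<le> (\<Sum>j=1..n. (\<sigma> j)\<^sup>2) + s / 2"
    using sum_quantile_le[OF u] s by simp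
  have "prob {\<epsilon> \<in> space (noise J). energy \<theta> \<epsilon> \<le> ?t}
    \<le> prob {\<epsilon> \<in> space (noise J). s / 2 \<le> \<bar>energy \<theta> \<epsilon> - (s + (\<Sum>j=1..n. (\<sigma> j)\<^sup>2))\<bar>}"
  proof (intro finite_measure_mono subsetI CollectI conjI; (elim CollectE conjE)?)
    show "s / 2 \<le> \<bar>energy \<theta> \<epsilon> - (s + (\<Sum>j=1..n. (\<sigma> j)\<^sup>2))\<bar>"
      if "energy \<theta> \<epsilon> \<le> ?t" for \<epsilon>
      using t that by linarith
  qed auto
  also have "\<dots> \<le> (4 * (\<Sum>j=1..n. (\<theta> j)\<^sup>2 * (\<sigma> j)\<^sup>2) + 2 * ?V\<^sup>2) / (s / 2)\<^sup>2"
    unfolding s_def by (rule energy_deviation) (use s in \<open>simp add: s_def\<close>)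
  also have "\<dots> \<le> (6 * (s * ?V)) / (s / 2)\<^sup>2"
  proof (rule divide_right_mono)
    have "1 * ?V \<le> C * ?V"
      using C V by (intro mult_right_mono) auto
    then have "?V \<le> s"
      using s by linarith
    then have "?V * ?V \<le> s * ?V"
      using V by (intro mult_right_mono) auto
    then show "4 * (\<Sum>j=1..n. (\<theta> j)\<^sup>2 * (\<sigma> j)\<^sup>2) + 2 * ?V\<^sup>2 \<le> 6 * (s * ?V)"
      using cross by (simp add: power2_eq_square)
  qed simp
  also have "\<dots> = 24 * ?V / s"
    using s by (simp add: power2_eq_square field_simps)
  also have "\<dots> \<le> 24 / C"
    using s C V by (simp add: field_simps)
  finally show ?thesis .
qed

section \<open>Power of the peak test\<close>

lemma peak_gt_iff: "x < peak \<theta> \<epsilon> \<longleftrightarrow> (\<exists>j\<in>{1..n}. x < (\<theta> j + \<sigma> j * \<epsilon> j)\<^sup>2 / (\<sigma> j)\<^sup>2)"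
  unfolding peak_def using n_pos by (subst Max_gr_iff) auto

lemma peak_null_tail:
  "prob {\<epsilon> \<in> space (noise J). x < peak (\<lambda>_. 0) \<epsilon>} \<le> real n * (2 * exp (- x / 4))"
proof -
  have "{\<epsilon> \<in> space (noise J). x < peak (\<lambda>_. 0) \<epsilon>} = (\<Union>j\<in>{1..n}. {\<epsilon> \<in> space (noise J). x < (\<epsilon> j)\<^sup>2})"
    unfolding peak_null using n_pos by (subst Max_gr_iff) auto
  then have "prob {\<epsilon> \<in> space (noise J). x < peak (\<lambda>_. 0) \<epsilon>}
      \<le> (\<Sum>j\<in>{1..n}. prob {\<epsilon> \<in> space (noise J). x < (\<epsilon> j)\<^sup>2})"
    by (simp only:) (intro finite_measure_subadditive_finite; auto)
  also have "\<dots> \<le> (\<Sum>j\<in>{1..n}. 2 * exp (- x / 4))"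
    using coordinate_prob[of _ "\<lambda>y. x < y\<^sup>2"] std_normal_square_tail[of x]
    by (intro sum_mono) auto
  finally show ?thesis by simp
qed

lemma half_le_ln:
  assumes "2 \<le> n"
  shows "1 / 2 \<le> ln (real n)"
proof -
  have "- ln (2 :: real) \<le> - (1 / 2)"
    using ln_le_minus_one[of "1 / 2 :: real"] by (simp add: ln_div)
  moreover have "ln (2 :: real) \<le> ln (real n)"
    using assms by simp
  ultimately show ?thesis
    by linarith
qed

text \<open>
  Each null coordinate exceeds \<^term>\<open>x\<close> with probability at most \<^term>\<open>2 * exp (- x / 4)\<close>, so the
  union bound over \<^term>\<open>n\<close> coordinates equals \<^term>\<open>u\<close> at \<^term>\<open>x = 4 * (ln (real n) + ln (2 / u))\<close>.
  Since \<^term>\<open>n \<ge> 2\<close> keeps \<^term>\<open>ln (real n)\<close> away from 0, the additive \<^term>\<open>ln (2 / u)\<close> can be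
  absorbed into a multiple of \<^term>\<open>ln (real n)\<close> that depends on \<^term>\<open>u\<close> only.
\<close>

lemma max_quantile_le:
  assumes u: "0 < u" "u < 1" and n: "2 \<le> n"
  shows "max_quantile J n (1 - u) \<le> (4 + 8 * ln (2 / u)) * ln (real n)"
proof -
  have "1 / 2 \<le> ln (real n)"
    using n by (rule half_le_ln)
  then have "ln (2 / u) * (1 / 2) \<le> ln (2 / u) * ln (real n)"
    using u by (intro mult_left_mono) auto
  moreover have "max_quantile J n (1 - u) \<le> 4 * (ln (real n) + ln (2 / u))"
  proof -
    have "- (4 * (ln (real n) + ln (2 / u))) / 4 = - (ln (real n) + ln (2 / u))"
      by simp
    also have "exp \<dots> = inverse (real n * (2 / u))"
      unfolding exp_minus exp_add using n u by simp
    finally have "exp (- (4 * (ln (real n) + ln (2 / u))) / 4) = inverse (real n * (2 / u))" .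
    then have "real n * (2 * exp (- (4 * (ln (real n) + ln (2 / u))) / 4)) = u"
      using n u by (simp add: field_simps)
    then show ?thesis
      using peak_null_tail[of "4 * (ln (real n) + ln (2 / u))"]
      by (simp only: max_quantile_le_iff[OF u])
  qed
  ultimately show ?thesis
    by (simp add: algebra_simps)
qed

text \<open>
  The signal-to-noise ratio \<open>m\<close> of the strong coordinate satisfies \<open>m\<^sup>2 \<ge> C ln n\<close>, at least four times
  the critical value. A miss then means \<open>(m + \<epsilon>\<^sub>j)\<^sup>2 \<le> (m / 2)\<^sup>2\<close>, so \<open>\<epsilon>\<^sub>j\<close> must cancel at least
  half of \<open>m\<close>.
\<close>

lemma peak_test_power:
  assumes u: "0 < u" "u < 1" and n: "2 \<le> n"
    and C: "0 < C" "4 * (4 + 8 * ln (2 / u)) \<le> C"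
    and j: "j \<in> {1..n}" and large: "C * (\<sigma> j)\<^sup>2 * ln (real n) \<le> (\<theta> j)\<^sup>2"
  shows "prob {\<epsilon> \<in> space (noise J). peak \<theta> \<epsilon> \<le> max_quantile J n (1 - u)} \<le> 8 / C"
proof -
  let ?q = "max_quantile J n (1 - u)"
  define m where "m = \<theta> j / \<sigma> j"
  have jJ: "j \<in> J" and \<sigma>: "0 < \<sigma> j"
    using j sigma_pos by auto
  have ln_n: "1 / 2 \<le> ln (real n)"
    using n by (rule half_le_ln)
  have m: "C * ln (real n) \<le> m\<^sup>2"
    using large \<sigma> by (simp add: m_def power_divide field_simps)
  have "4 * ?q \<le> 4 * (4 + 8 * ln (2 / u)) * ln (real n)"
    using max_quantile_le[OF u n] by linarith
  also have "\<dots> \<le> C * ln (real n)"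
    using C ln_n by (intro mult_right_mono) auto
  finally have q: "?q \<le> m\<^sup>2 / 4"
    using m by simp
  have "0 < C * ln (real n)"
    using C ln_n by simp
  then have m_pos: "0 < m\<^sup>2"
    using m by linarith
  have event: "m\<^sup>2 / 4 \<le> (\<epsilon> j)\<^sup>2" if "peak \<theta> \<epsilon> \<le> ?q" for \<epsilon>
  proof -
    have "(\<theta> j + \<sigma> j * \<epsilon> j)\<^sup>2 / (\<sigma> j)\<^sup>2 \<le> m\<^sup>2 / 4"
      using that q peak_gt_iff[of "m\<^sup>2 / 4" \<theta> \<epsilon>] j by (auto simp: not_less[symmetric])
    moreover have "(\<theta> j + \<sigma> j * \<epsilon> j)\<^sup>2 / (\<sigma> j)\<^sup>2 = (m + \<epsilon> j)\<^sup>2"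
      using \<sigma> by (simp add: m_def field_simps flip: power_divide)
    ultimately have "(m + \<epsilon> j)\<^sup>2 \<le> (m / 2)\<^sup>2"
      by (simp add: power_divide)
    then have "\<bar>m + \<epsilon> j\<bar> \<le> \<bar>m / 2\<bar>"
      by (simp only: abs_le_square_iff)
    then have "\<bar>m / 2\<bar> \<le> \<bar>\<epsilon> j\<bar>"
      by linarith
    then have "(m / 2)\<^sup>2 \<le> (\<epsilon> j)\<^sup>2"
      by (simp only: abs_le_square_iff)
    then show ?thesis
      by (simp add: power_divide)
  qed
  have "prob {\<epsilon> \<in> space (noise J). peak \<theta> \<epsilon> \<le> ?q} \<le> prob {\<epsilon> \<in> space (noise J). m\<^sup>2 / 4 \<le> (\<epsilon> j)\<^sup>2}"
    using event jJ by (intro finite_measure_mono) auto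
  also have "\<dots> \<le> 1 / (m\<^sup>2 / 4)"
    using coordinate_prob[of j "\<lambda>y. m\<^sup>2 / 4 \<le> y\<^sup>2"] std_normal_square_Markov[of "m\<^sup>2 / 4"] jJ m_pos
    by auto
  also have "\<dots> \<le> 8 / C"
  proof -
    have "C * (1 / 2) \<le> C * ln (real n)"
      using C ln_n by (intro mult_left_mono) auto
    then have "C \<le> 2 * m\<^sup>2"
      using m by simp
    then show ?thesis
      using C m_pos by (simp add: field_simps)
  qed
  finally show ?thesis .
qed

section \<open>Power of the combined test and the minimax bound\<close>

lemma l2_norm_sq:
  assumes "\<theta> \<in> sparse_class J k n"
  shows "(l2_norm J \<theta>)\<^sup>2 = (\<Sum>j=1..n. (\<theta> j)\<^sup>2)"
proof -
  have "(\<Sum>\<^sub>\<infinity>j\<in>J. (\<theta> j)\<^sup>2) = (\<Sum>\<^sub>\<infinity>j\<in>{1..n}. (\<theta> j)\<^sup>2)"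
    using assms J_ge_1 by (intro infsum_cong_neutral) (force simp: sparse_class_def)+
  then show ?thesis
    by (simp add: l2_norm_def sum_nonneg)
qed

lemma support_subset:
  assumes "\<theta> \<in> sparse_class J k n"
  shows "{j \<in> J. \<theta> j \<noteq> 0} \<subseteq> {1..n}" "card {j \<in> J. \<theta> j \<noteq> 0} \<le> k"
proof -
  have *: "j \<le> n" if "j \<in> J" "\<theta> j \<noteq> 0" for j
    using assms that unfolding sparse_class_def by (blast intro: leI)
  show "{j \<in> J. \<theta> j \<noteq> 0} \<subseteq> {1..n}"
    by (intro subsetI, elim CollectE conjE) (meson * J_ge_1 atLeastAtMost_iff)
  have "{j \<in> J. \<theta> j \<noteq> 0} = {j \<in> J. j \<le> n \<and> \<theta> j \<noteq> 0}"
    by (rule Collect_cong) (meson *)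
  moreover have "card {j \<in> J. j \<le> n \<and> \<theta> j \<noteq> 0} \<le> k"
    using assms by (simp add: sparse_class_def)
  ultimately show "card {j \<in> J. \<theta> j \<noteq> 0} \<le> k"
    by (simp only:)
qed

lemma support_nonempty:
  assumes "\<theta> \<in> sparse_class J k n" "\<theta> \<noteq> zero_signal J"
  shows "{j \<in> J. \<theta> j \<noteq> 0} \<noteq> {}"
proof
  assume "{j \<in> J. \<theta> j \<noteq> 0} = {}"
  then have "\<theta> = zero_signal J"
    using assms(1) by (auto simp: sparse_class_def l2_def zero_signal_def extensional_def fun_eq_iff)
  then show False
    using assms(2) by simp
qed

lemma combined_test_power:
  assumes \<alpha>: "0 < \<alpha>" "\<alpha> < 1" and n: "2 \<le> n"
    and C: "1 \<le> C" "2 * sqrt (4 / \<alpha>) \<le> C" "4 * (4 + 8 * ln (4 / \<alpha>)) \<le> C"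
    and \<theta>: "\<theta> \<in> sparse_class J k n" "\<theta> \<noteq> zero_signal J"
    and large: "C * min noise_scale ((\<Sum>j\<in>{j \<in> J. \<theta> j \<noteq> 0}. (\<sigma> j)\<^sup>2) * ln (real n)) \<le> (l2_norm J \<theta>)\<^sup>2"
  shows "1 - 24 / C \<le> reject_prob J \<sigma> \<theta> (combined_test J \<sigma> n \<alpha>)"
proof -
  let ?t = "sum_quantile J \<sigma> n (1 - \<alpha> / 2)" and ?q = "max_quantile J n (1 - \<alpha> / 2)"
  let ?T = "{j \<in> J. \<theta> j \<noteq> 0}"
  let ?E = "{\<epsilon> \<in> space (noise J). energy \<theta> \<epsilon> \<le> ?t}"
  let ?P = "{\<epsilon> \<in> space (noise J). peak \<theta> \<epsilon> \<le> ?q}"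
  note T = support_subset[OF \<theta>(1)]
  have u: "0 < \<alpha> / 2" "\<alpha> / 2 < 1"
    using \<alpha> by auto
  have miss: "prob (?E \<inter> ?P) \<le> 24 / C"
  proof (cases "C * noise_scale \<le> (l2_norm J \<theta>)\<^sup>2")
    case True
    have "prob (?E \<inter> ?P) \<le> prob ?E"
      by (intro finite_measure_mono) auto
    also have "\<dots> \<le> 24 / C"
      using True C by (intro energy_test_power[OF u]) (simp_all add: l2_norm_sq[OF \<theta>(1)])
    finally show ?thesis .
  next
    case False
    then have strong: "C * ((\<Sum>j\<in>?T. (\<sigma> j)\<^sup>2) * ln (real n)) \<le> (l2_norm J \<theta>)\<^sup>2"
      using large by (auto simp: min_def split: if_splits)
    \<comment> \<open>Otherwise summing the reverse inequalities over the nonempty support contradicts the bound on the norm.\<close>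
    obtain j where j: "j \<in> ?T" "C * (\<sigma> j)\<^sup>2 * ln (real n) \<le> (\<theta> j)\<^sup>2"
    proof (rule ccontr)
      assume "\<not> thesis"
      then have "(\<Sum>j\<in>?T. (\<theta> j)\<^sup>2) < (\<Sum>j\<in>?T. C * (\<sigma> j)\<^sup>2 * ln (real n))"
        using that support_nonempty[OF \<theta>] finite_subset[OF T(1)]
        by (intro sum_strict_mono) (auto simp: not_le[symmetric])
      also have "\<dots> = C * ((\<Sum>j\<in>?T. (\<sigma> j)\<^sup>2) * ln (real n))"
        by (simp add: sum_distrib_left sum_distrib_right mult.assoc)
      also have "\<dots> \<le> (\<Sum>j=1..n. (\<theta> j)\<^sup>2)"
        using strong by (simp add: l2_norm_sq[OF \<theta>(1)])
      also have "\<dots> = (\<Sum>j\<in>?T. (\<theta> j)\<^sup>2)"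
        using T(1) by (intro sum.mono_neutral_right) auto
      finally show False by simp
    qed
    have "prob (?E \<inter> ?P) \<le> prob ?P"
      by (intro finite_measure_mono) auto
    also have "\<dots> \<le> 8 / C"
      using C j T(1) by (intro peak_test_power[OF u n]) auto
    also have "\<dots> \<le> 24 / C"
      using C by (simp add: divide_right_mono)
    finally show ?thesis .
  qed
  have "reject_prob J \<sigma> \<theta> (combined_test J \<sigma> n \<alpha>) =
      prob {\<epsilon> \<in> space (noise J). \<not> (energy \<theta> \<epsilon> \<le> ?t \<and> peak \<theta> \<epsilon> \<le> ?q)}"
    unfolding reject_prob_combined_test by (intro arg_cong[where f=prob]) auto
  also have "\<dots> = 1 - prob {\<epsilon> \<in> space (noise J). energy \<theta> \<epsilon> \<le> ?t \<and> peak \<theta> \<epsilon> \<le> ?q}"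
    by (rule prob_neg) measurable
  also have "{\<epsilon> \<in> space (noise J). energy \<theta> \<epsilon> \<le> ?t \<and> peak \<theta> \<epsilon> \<le> ?q} = ?E \<inter> ?P"
    by auto
  finally show ?thesis
    using miss by simp
qed

end

text \<open>
  The radius is an infimum over radii at which the infimum of the power is strictly larger than
  \<^term>\<open>1 - \<beta>\<close>. A pointwise strict bound could be lost in that infimum, hence the uniform bound \<^term>\<open>c\<close>.
\<close>

lemma minimax_rate_sq_le:
  assumes level: "level_test J \<sigma> \<alpha> \<Phi>" and R: "0 < R" and c: "1 - \<beta> < c"
    and power: "\<And>\<theta>. \<theta> \<in> F \<Longrightarrow> R \<le> (l2_norm J \<theta>)\<^sup>2 \<Longrightarrow> c \<le> reject_prob J \<sigma> \<theta> \<Phi>"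
  shows "(minimax_rate J \<sigma> F \<alpha> \<beta>)\<^sup>2 \<le> ereal R"
proof -
  have norm_nonneg: "0 \<le> l2_norm J \<theta>" for \<theta>
    by (simp add: l2_norm_def infsum_nonneg)
  have "ereal (1 - \<beta>) < ereal c"
    using c by simp
  also have "ereal c \<le> (INF \<theta>\<in>{\<theta> \<in> F. sqrt R \<le> l2_norm J \<theta>}. ereal (reject_prob J \<sigma> \<theta> \<Phi>))"
    using norm_nonneg power by (intro INF_greatest) (auto intro!: power simp: sqrt_le_D)
  finally have radius: "test_radius J \<sigma> \<Phi> F \<beta> \<le> ereal (sqrt R)"
    unfolding test_radius_def using R by (intro Inf_lower) auto
  have upper: "minimax_rate J \<sigma> F \<alpha> \<beta> \<le> ereal (sqrt R)"
    unfolding minimax_rate_def using level radius by (intro INF_lower2[of \<Phi>]) auto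
  have lower: "0 \<le> minimax_rate J \<sigma> F \<alpha> \<beta>"
    unfolding minimax_rate_def test_radius_def by (intro INF_greatest Inf_greatest) auto
  obtain r where r: "minimax_rate J \<sigma> F \<alpha> \<beta> = ereal r" "0 \<le> r" "r \<le> sqrt R"
    using upper lower by (cases "minimax_rate J \<sigma> F \<alpha> \<beta>") auto
  have "r\<^sup>2 \<le> (sqrt R)\<^sup>2"
    using r by (intro power_mono)
  then show ?thesis
    using r R by simp
qed

theorem theorem2:
  fixes \<alpha> \<beta> :: real
  assumes "0 < \<alpha>" and "\<alpha> < 1" and "0 < \<beta>" and "\<beta> < 1"
  shows "\<exists>C>0. \<forall>(J :: nat set) (\<sigma> :: nat \<Rightarrow> real) (n :: nat) (k :: nat).
    index_set J \<longrightarrow> (\<forall>j\<in>J. 0 < \<sigma> j) \<longrightarrow> 1 \<le> n \<longrightarrow> {1..n} \<subseteq> J \<longrightarrow> 1 \<le> k \<longrightarrow> k \<le> n \<longrightarrow>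
      level_test J \<sigma> \<alpha> (combined_test J \<sigma> n \<alpha>) \<and>
      (2 \<le> n \<longrightarrow>
        (\<forall>\<theta>\<in>sparse_class J k n. \<theta> \<noteq> zero_signal J \<longrightarrow>
          (l2_norm J \<theta>)\<^sup>2 \<ge> C * min (sqrt (\<Sum>j=1..n. \<sigma> j ^ 4))
                                    ((\<Sum>j\<in>{j \<in> J. \<theta> j \<noteq> 0}. (\<sigma> j)\<^sup>2) * ln (real n)) \<longrightarrow>
          reject_prob J \<sigma> \<theta> (combined_test J \<sigma> n \<alpha>) > 1 - \<beta>) \<and>
        (minimax_rate J \<sigma> (sparse_class J k n) \<alpha> \<beta>)\<^sup>2
          \<le> ereal (C * min (sqrt (\<Sum>j=1..n. \<sigma> j ^ 4)) (Sigma_sq \<sigma> n k * ln (real n))))"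
proof -
  \<comment> \<open>The second and third entries are the thresholds of the two power bounds at level \<open>u = \<alpha> / 2\<close>;
    the last one makes the bound \<open>24 / C\<close> on the miss probability at most \<open>\<beta> / 2\<close>.\<close>
  define C where "C = Max {1, 2 * sqrt (4 / \<alpha>), 4 * (4 + 8 * ln (4 / \<alpha>)), 48 / \<beta>}"
  have C: "1 \<le> C" "2 * sqrt (4 / \<alpha>) \<le> C" "4 * (4 + 8 * ln (4 / \<alpha>)) \<le> C" "48 / \<beta> \<le> C"
    by (simp_all add: C_def)
  have "24 / C \<le> \<beta> / 2"
    using C assms by (simp add: field_simps)
  then have margin: "1 - \<beta> < 1 - 24 / C"
    using assms by simp
  show ?thesis
  proof (intro exI[of _ C] conjI allI impI)
    show "0 < C"
      using C by simp
  next
    fix J :: "nat set" and \<sigma> :: "nat \<Rightarrow> real" and n k :: nat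
    assume model: "index_set J" "\<forall>j\<in>J. 0 < \<sigma> j" "1 \<le> n" "{1..n} \<subseteq> J" and k: "1 \<le> k" "k \<le> n"
    interpret gaussian_sequence J \<sigma> n
      using model by unfold_locales auto
    show level: "level_test J \<sigma> \<alpha> (combined_test J \<sigma> n \<alpha>)"
      using assms by (intro combined_test_level)
    assume n: "2 \<le> n"
    note power = combined_test_power[OF assms(1,2) n C(1-3)]
    show "\<forall>\<theta>\<in>sparse_class J k n. \<theta> \<noteq> zero_signal J \<longrightarrow>
        C * min (sqrt (\<Sum>j=1..n. \<sigma> j ^ 4)) ((\<Sum>j\<in>{j \<in> J. \<theta> j \<noteq> 0}. (\<sigma> j)\<^sup>2) * ln (real n))
          \<le> (l2_norm J \<theta>)\<^sup>2 \<longrightarrow>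
        1 - \<beta> < reject_prob J \<sigma> \<theta> (combined_test J \<sigma> n \<alpha>)"
      using power margin unfolding noise_scale_def by force
    let ?R = "C * min noise_scale (Sigma_sq \<sigma> n k * ln (real n))"
    \<comment> \<open>The bound on the squared rate must be positive, since radii are; hence a singleton support.\<close>
    have "0 < (\<Sum>j\<in>{1}. (\<sigma> j)\<^sup>2)"
      using sigma_pos[of 1] n by simp
    also have "\<dots> \<le> Sigma_sq \<sigma> n k"
      using k sigma_pos by (intro sum_le_Sigma_sq) auto
    finally have "0 < Sigma_sq \<sigma> n k" .
    then have R: "0 < ?R"
      using C n noise_scale_pos by simp
    have "(minimax_rate J \<sigma> (sparse_class J k n) \<alpha> \<beta>)\<^sup>2 \<le> ereal ?R"
    proof (rule minimax_rate_sq_le[OF level R margin])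
      fix \<theta>
      assume \<theta>: "\<theta> \<in> sparse_class J k n" and large: "?R \<le> (l2_norm J \<theta>)\<^sup>2"
      have "\<theta> \<noteq> zero_signal J"
      proof
        assume "\<theta> = zero_signal J"
        then have "(l2_norm J \<theta>)\<^sup>2 = 0"
          unfolding l2_norm_sq[OF \<theta>] by (simp add: zero_signal_def)
        then show False
          using R large by linarith
      qed
      moreover have "(\<Sum>j\<in>{j \<in> J. \<theta> j \<noteq> 0}. (\<sigma> j)\<^sup>2) \<le> Sigma_sq \<sigma> n k"
        using support_subset[OF \<theta>] k sigma_pos by (intro sum_le_Sigma_sq) auto
      then have "C * min noise_scale ((\<Sum>j\<in>{j \<in> J. \<theta> j \<noteq> 0}. (\<sigma> j)\<^sup>2) * ln (real n)) \<le> ?R"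
        using C n by (intro mult_left_mono min.mono mult_right_mono) auto
      ultimately show "1 - 24 / C \<le> reject_prob J \<sigma> \<theta> (combined_test J \<sigma> n \<alpha>)"
        using large by (intro power[OF \<theta>]) auto
    qed
    then show "(minimax_rate J \<sigma> (sparse_class J k n) \<alpha> \<beta>)\<^sup>2
        \<le> ereal (C * min (sqrt (\<Sum>j=1..n. \<sigma> j ^ 4)) (Sigma_sq \<sigma> n k * ln (real n)))"
      by (simp only: noise_scale_def)
  qed
qed

end
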